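(* Let $\alpha>0$ be arbitrary and let $g\in C(\mathbb{D})$ be such that $|g(z)|\le M(1-|z|^2)^{-\alpha}$ for all $z\in\mathbb{D}$, for some $M>0$. Let $G_\alpha[g]$ be the Green potential of $g$, $$G_\alpha[g](w)=\iint_{\mathbb{D}}G_\alpha(z,w)\,g(z)\,dx\,dy,\qquad w\in\mathbb{D}.$$ Then $\frac{\partial}{\partial w}G_\alpha[g]$ and $\frac{\partial}{\partial\overline w}G_\alpha[g]$ are both bounded in $\mathbb{D}$.
   Context: $\mathbb{D}=\{z\in\mathbb{C}:|z|<1\}$, $z=x+iy$; $\frac{\partial}{\partial w}$ and $\frac{\partial}{\partial\overline w}$ are the Wirtinger derivatives $\frac12(\partial_{\operatorname{Re}w}\mp i\,\partial_{\operatorname{Im}w})$. For $z,w\in\mathbb{D}$ with $z\neq w$, $$G_\alpha(z,w)=\frac{(1-\overline z w)^\alpha\,h(q(z,w))}{2\pi},\quad h(r)=\frac12\int_0^{1-r^2}\frac{t^\alpha}{1-t}\,dt,\quad q(z,w)=\left|\frac{z-w}{1-\overline w z}\right|,$$ where the power of $1-\overline z w$ (which has positive real part) is taken with the principal branch. *)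

theory Defs
  imports "HOL-Analysis.Analysis"
begin

definition unit_disc :: "complex set" ("\<bbbD>") where
  "\<bbbD> = ball 0 1"

definition partial_Re :: "(complex \<Rightarrow> complex) \<Rightarrow> complex \<Rightarrow> complex" where
  "partial_Re f w = vector_derivative (\<lambda>t::real. f (w + of_real t)) (at 0)"

definition partial_Im :: "(complex \<Rightarrow> complex) \<Rightarrow> complex \<Rightarrow> complex" where
  "partial_Im f w = vector_derivative (\<lambda>t::real. f (w + \<i> * of_real t)) (at 0)"

text \<open>Since \<^const>\<open>vector_derivative\<close> is total, existence of the two partial derivatives has to
  be expressed separately.\<close>

definition has_partials_at :: "(complex \<Rightarrow> complex) \<Rightarrow> complex \<Rightarrow> bool" where
  "has_partials_at f w \<longleftrightarrow>
     (\<lambda>t::real. f (w + of_real t)) differentiable (at 0) \<and>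
     (\<lambda>t::real. f (w + \<i> * of_real t)) differentiable (at 0)"

definition wirtinger :: "(complex \<Rightarrow> complex) \<Rightarrow> complex \<Rightarrow> complex" where
  "wirtinger f w = (partial_Re f w - \<i> * partial_Im f w) / 2"

definition wirtinger_bar :: "(complex \<Rightarrow> complex) \<Rightarrow> complex \<Rightarrow> complex" where
  "wirtinger_bar f w = (partial_Re f w + \<i> * partial_Im f w) / 2"

definition green_h :: "real \<Rightarrow> real \<Rightarrow> real" where
  "green_h \<alpha> r = (1/2) * (LINT t:{0..1 - r\<^sup>2}|lborel. t powr \<alpha> / (1 - t))"

definition pseudohyp_dist :: "complex \<Rightarrow> complex \<Rightarrow> real" where
  "pseudohyp_dist z w = norm ((z - w) / (1 - cnj w * z))"

text \<open>The complex power \<open>powr\<close> is the principal branch. The kernel is meaningful for distinct points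
  of the disc; on the diagonal the integral in \<^const>\<open>green_h\<close> diverges and the value obtained
  is arbitrary, which is immaterial for the area integral below.\<close>

definition green_kernel :: "real \<Rightarrow> complex \<Rightarrow> complex \<Rightarrow> complex" where
  "green_kernel \<alpha> z w =
     (1 - cnj z * w) powr (of_real \<alpha>) * of_real (green_h \<alpha> (pseudohyp_dist z w)) / (2 * of_real pi)"

definition green_potential :: "real \<Rightarrow> (complex \<Rightarrow> complex) \<Rightarrow> complex \<Rightarrow> complex" where
  "green_potential \<alpha> g w = (LINT z:\<bbbD>|lborel. green_kernel \<alpha> z w * g z)"

end

theory Submission
  imports Defs
begin

text \<open>
  Put \<open>A = 1 - cnj z * w\<close> and \<open>s = 1 - q\<^sup>2 = (1 - |z|\<^sup>2)(1 - |w|\<^sup>2) / |A|\<^sup>2\<close>. The hypothesis on \<open>g\<close> together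
  with \<open>1 - |w|\<^sup>2 \<le> 2|A|\<close> gives \<open>s\<^sup>\<alpha> |g(z)| \<le> M (2 / |A|)\<^sup>\<alpha>\<close>, which cancels the factor \<open>|A|\<^sup>\<alpha>\<close> of
  the kernel. Since \<open>h(q) \<le> s\<^sup>\<alpha> ln (1/q) \<le> s\<^sup>\<alpha> |A| / |z - w|\<close> and the directional derivatives of \<open>s\<close>
  in \<open>w\<close> are at most \<open>4|z - w| / |A|\<^sup>2\<close> while \<open>1 - s = |z - w|\<^sup>2 / |A|\<^sup>2\<close>, both the kernel times \<open>g\<close> and its
  first order derivatives in \<open>w\<close> are \<open>O(1 / |z - w|)\<close>, uniformly on the disc. For kernels with such a
  singularity one may differentiate under the integral sign: integrate the derivative along a
  segment and apply Fubini's theorem.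
\<close>

subsection \<open>Weakly singular kernels\<close>

text \<open>Dyadic decomposition: on the annulus \<open>R / 2^(n+1) \<le> norm u < R / 2^n\<close>
  the function is at most \<open>2^(n+1) / R\<close>, while the enclosing ball has area
  \<open>pi * R^2 / 4^n\<close>. The resulting series is geometric with ratio 1/2.\<close>

lemma nn_integral_inverse_norm_ball:
  fixes R :: real
  assumes "R > 0"
  shows "(\<integral>\<^sup>+u. ennreal (indicator (ball (0::complex) R) u * (1 / norm u)) \<partial>lborel) < \<infinity>"
proof -
  have pt: "ennreal (indicator (ball (0::complex) R) u * (1 / norm u))
      \<le> (\<Sum>n. ennreal (2 ^ Suc n / R) * indicator (ball (0::complex) (R / 2 ^ n)) u)" for u :: complex
  proof (cases "u \<noteq> 0 \<and> norm u < R")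
    case True
    then have pos: "norm u > 0" by simp
    \<comment> \<open>\<open>P n\<close> says that \<open>u\<close> lies outside the
      \<open>n\<close>-th dyadic ball. It fails for \<open>n = 0\<close> and holds eventually, so
      the index where it switches identifies the annulus containing \<open>u\<close>.\<close>
    define P where "P n \<longleftrightarrow> R / 2 ^ n \<le> norm u" for n :: nat
    obtain n0 where "(1/2) ^ n0 < norm u / R"
      using real_arch_pow_inv[of "norm u / R" "1/2"] pos assms by auto
    then have "P n0"
      using assms by (simp add: P_def pos_less_divide_eq power_one_over mult.commute)
    moreover have "\<not> P 0" using True by (simp add: P_def)
    ultimately have "\<exists>n. \<not> P n \<and> P (Suc n)" by (induction n0) auto
    then obtain n where n: "\<not> P n" "P (Suc n)" by blast
    have "1 / norm u \<le> 2 ^ Suc n / R"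
      using n(2) pos assms by (simp add: P_def field_simps)
    then have "ennreal (indicator (ball (0::complex) R) u * (1 / norm u)) \<le> ennreal (2 ^ Suc n / R) * indicator (ball (0::complex) (R / 2 ^ n)) u"
      using n(1) True by (auto simp: P_def indicator_def intro!: ennreal_leI)
    also have "\<dots> = (\<Sum>k\<in>{n}. ennreal (2 ^ Suc k / R) * indicator (ball 0 (R / 2 ^ k)) u)"
      by (subst sum.insert) simp_all
    also have "\<dots> \<le> (\<Sum>k. ennreal (2 ^ Suc k / R) * indicator (ball 0 (R / 2 ^ k)) u)"
      by (rule sum_le_suminf) auto
    finally show ?thesis .
  next
    case False
    \<comment> \<open>The left-hand side is 0 here: outside the ball by the indicator, and at
      \<open>u = 0\<close> because \<open>1 / 0 = 0\<close>.\<close>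
    then show ?thesis by (auto simp: indicator_def)
  qed
  have "(\<integral>\<^sup>+u. ennreal (indicator (ball (0::complex) R) u * (1 / norm u)) \<partial>lborel)
      \<le> (\<integral>\<^sup>+u. (\<Sum>n. ennreal (2 ^ Suc n / R) * indicator (ball (0::complex) (R / 2 ^ n)) u) \<partial>lborel)"
    by (intro nn_integral_mono pt)
  also have "\<dots> = (\<Sum>n. \<integral>\<^sup>+u. ennreal (2 ^ Suc n / R) * indicator (ball (0::complex) (R / 2 ^ n)) u \<partial>lborel)"
    by (rule nn_integral_suminf) (intro borel_measurable_times_ennreal borel_measurable_const borel_measurable_indicator, simp)
  also have "\<dots> = (\<Sum>n. ennreal (2 * pi * R * (1/2) ^ n))"
  proof (intro suminf_cong)
    fix n :: nat
    have "(\<integral>\<^sup>+u. ennreal (2 ^ Suc n / R) * indicator (ball (0::complex) (R / 2 ^ n)) u \<partial>lborel)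
        = ennreal (2 ^ Suc n / R) * ennreal (pi * (R / 2 ^ n)\<^sup>2)"
      using assms by (simp add: nn_integral_cmult_indicator emeasure_ball unit_ball_vol_2)
    also have "\<dots> = ennreal (2 ^ Suc n / R * (pi * (R / 2 ^ n)\<^sup>2))"
      using assms by (subst ennreal_mult) simp_all
    also have "2 ^ Suc n / R * (pi * (R / 2 ^ n)\<^sup>2) = 2 * pi * R * (1/2) ^ n"
      using assms by (simp add: field_simps power2_eq_square)
    finally show "(\<integral>\<^sup>+u. ennreal (2 ^ Suc n / R) * indicator (ball (0::complex) (R / 2 ^ n)) u \<partial>lborel)
        = ennreal (2 * pi * R * (1/2) ^ n)" .
  qed
  also have "\<dots> < \<infinity>"
    using assms by (subst suminf_ennreal2) (auto intro!: summable_mult summable_geometric)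
  finally show ?thesis .
qed

lemma integrable_inverse_norm_ball:
  "integrable lborel (\<lambda>u::complex. indicator (ball (0::complex) R) u * (1 / norm u))"
proof (cases "R > 0")
  case True
  show ?thesis
  proof (rule integrableI_bounded)
    show "(\<lambda>u::complex. indicator (ball 0 R) u * (1 / norm u)) \<in> borel_measurable lborel"
      by (intro borel_measurable_times borel_measurable_indicator borel_measurable_divide
          borel_measurable_const borel_measurable_norm) auto
    show "(\<integral>\<^sup>+u. ennreal (norm (indicator (ball (0::complex) R) u * (1 / norm u))) \<partial>lborel) < \<infinity>"
      using nn_integral_inverse_norm_ball[OF True] by (simp add: abs_mult)
  qed
next
  case False
  then show ?thesis by (simp add: ball_empty)
qed

section \<open>Bounds and continuity for weakly singular integrals\<close>

text \<open>Kernels are extended by \<open>0\<close> off \<open>U \<times> U\<close> and on the diagonal, so that measurability and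
  the singular bound hold without side conditions.\<close>

definition off_diagonal ::
  "complex set \<Rightarrow> (complex \<Rightarrow> complex \<Rightarrow> complex) \<Rightarrow> complex \<Rightarrow> complex \<Rightarrow> complex" where
  "off_diagonal U F z w = (if z \<in> U \<and> w \<in> U \<and> z \<noteq> w then F z w else 0)"

text \<open>The singularity \<open>1 / norm (z - w)\<close> is integrable in the plane. The number
  \<open>R\<close> confines \<open>z - w\<close> to one ball for all \<open>w\<close>, so every
  estimate below is uniform in \<open>w\<close>.\<close>

locale weakly_singular =
  fixes U :: "complex set" and F :: "complex \<Rightarrow> complex \<Rightarrow> complex" and C R :: real
  assumes open_U: "open U"
    and diam: "\<And>z w. z \<in> U \<Longrightarrow> w \<in> U \<Longrightarrow> norm (z - w) < R"
    and continuous: "continuous_on {p. fst p \<in> U \<and> snd p \<in> U \<and> fst p \<noteq> snd p} (\<lambda>p. F (fst p) (snd p))"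
    and bound: "\<And>z w. z \<in> U \<Longrightarrow> w \<in> U \<Longrightarrow> z \<noteq> w \<Longrightarrow> norm (F z w) \<le> C / norm (z - w)"
    and C_nonneg: "C \<ge> 0"
begin

abbreviation "K \<equiv> off_diagonal U F"

lemma open_domain: "open {p. fst p \<in> U \<and> snd p \<in> U \<and> fst p \<noteq> snd p}"
proof -
  have "{p. fst p \<in> U \<and> snd p \<in> U \<and> fst p \<noteq> snd p} = U \<times> U \<inter> {p. fst p \<noteq> snd p}" by auto
  then show ?thesis
    by (auto intro!: open_Int open_Times open_U open_Collect_neq continuous_on_fst continuous_on_snd continuous_on_id)
qed

text \<open>\<open>K\<close> is a continuous function on an open set, extended by 0. Joint
  measurability is what Fubini's theorem will require.\<close>

lemma measurable_K [measurable]: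
  "case_prod K \<in> borel_measurable (borel \<Otimes>\<^sub>M borel)"
proof -
  have "(\<lambda>p. indicator {p. fst p \<in> U \<and> snd p \<in> U \<and> fst p \<noteq> snd p} p *\<^sub>R F (fst p) (snd p)) \<in> borel_measurable borel"
    using borel_measurable_continuous_on_indicator[OF borel_open[OF open_domain] continuous] .
  also have "(\<lambda>p. indicator {p. fst p \<in> U \<and> snd p \<in> U \<and> fst p \<noteq> snd p} p *\<^sub>R F (fst p) (snd p)) = case_prod K"
    by (auto simp: fun_eq_iff off_diagonal_def indicator_def)
  finally show ?thesis by (simp add: borel_prod)
qed

lemma norm_K_le: "norm (K z w) \<le> C * (indicator (ball 0 R) (z - w) * (1 / norm (z - w)))"
  using bound[of z w] diam[of z w] C_nonneg by (auto simp: off_diagonal_def)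

lemma norm_K_translate_le: "norm (K (w + u) w) \<le> C * (indicator (ball 0 R) u * (1 / norm u))"
  using norm_K_le[of "w + u" w] by (simp only: add_diff_cancel_left')

lemma isCont_K:
  assumes "z \<in> U" "w \<in> U" "z \<noteq> w"
  shows "isCont (\<lambda>p. K (fst p) (snd p)) (z, w)"
proof -
  have "isCont (\<lambda>p. F (fst p) (snd p)) (z, w)"
    using continuous_on_eq_continuous_at[OF open_domain] continuous assms by auto
  moreover have "\<forall>\<^sub>F p in nhds (z, w). F (fst p) (snd p) = K (fst p) (snd p)"
    by (rule eventually_mono[OF eventually_nhds_in_open[OF open_domain]])
       (use assms in \<open>auto simp: off_diagonal_def\<close>)
  ultimately show ?thesis by (subst (asm) isCont_cong)
qed

lemma integrable_translate:
  "integrable lborel (\<lambda>u. K (w + u) w)"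
  by (rule Bochner_Integration.integrable_bound[OF integrable_mult_right[OF integrable_inverse_norm_ball[of R], of C]])
     (use norm_K_translate_le C_nonneg in \<open>auto simp: abs_mult\<close>)

lemma integrable_K: "integrable lborel (\<lambda>z. K z w)"
proof -
  have "integrable (distr lborel borel ((+) w)) (\<lambda>z. K z w)"
    by (subst integrable_distr_eq) (auto intro: integrable_translate)
  then show ?thesis by (simp add: lborel_distr_plus)
qed

lemma integral_translate: "(\<integral>z. K z w \<partial>lborel) = (\<integral>u. K (w + u) w \<partial>lborel)"
  by (subst lborel_distr_plus[of w, symmetric], subst integral_distr) auto

text \<open>The substitution \<open>z = w + u\<close> makes the bound independent of
  \<open>w\<close>. This one constant supplies both the integrability for Fubini's theorem and the
  final bound on the derivatives.\<close>

lemma integral_norm_le: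
  "(\<integral>z. norm (K z w) \<partial>lborel) \<le> C * (\<integral>u. indicator (ball (0::complex) R) u * (1 / norm u) \<partial>lborel)"
proof -
  have "(\<integral>z. norm (K z w) \<partial>lborel) = (\<integral>u. norm (K (w + u) w) \<partial>lborel)"
    by (subst lborel_distr_plus[of w, symmetric], subst integral_distr) auto
  also have "\<dots> \<le> (\<integral>u. C * (indicator (ball (0::complex) R) u * (1 / norm u)) \<partial>lborel)"
    by (rule Bochner_Integration.integral_mono[OF integrable_norm[OF integrable_translate] integrable_mult_right[OF integrable_inverse_norm_ball]])
       (rule norm_K_translate_le)
  finally show ?thesis by (simp only: integral_mult_right_zero)
qed

lemma norm_integral_le:
  "norm (\<integral>z. K z w \<partial>lborel) \<le> C * (\<integral>u. indicator (ball (0::complex) R) u * (1 / norm u) \<partial>lborel)"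
  by (rule order_trans[OF integral_norm_bound integral_norm_le])

lemma off_diagonal_AE: 
  assumes "w \<in> U"
  shows "AE z in lborel. indicator U z *\<^sub>R F z w = K z w"
  using AE_lborel_singleton[of w] by eventually_elim (use assms in \<open>auto simp: off_diagonal_def\<close>)

text \<open>The value \<open>F w w\<close> on the diagonal is arbitrary, but it enters at the single
  point \<open>z = w\<close> only; adding it back to \<open>K\<close> gives the unmodified
  section.\<close>

lemma measurable_section:
  assumes "w \<in> U"
  shows "(\<lambda>z. indicator U z *\<^sub>R F z w) \<in> borel_measurable borel"
proof -
  have "(\<lambda>z. K z w + indicator {w} z *\<^sub>R F w w) \<in> borel_measurable borel" by measurable
  also have "(\<lambda>z. K z w + indicator {w} z *\<^sub>R F w w) = (\<lambda>z. indicator U z *\<^sub>R F z w)"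
    using assms by (auto simp: fun_eq_iff off_diagonal_def indicator_def)
  finally show ?thesis .
qed

lemma set_integrable_kernel:
  assumes "w \<in> U"
  shows "set_integrable lborel U (\<lambda>z. F z w)"
  unfolding set_integrable_def
  by (rule integrable_cong_AE_imp[OF integrable_K[of w]])
     (use measurable_section[OF assms] off_diagonal_AE[OF assms] in auto)

lemma set_integral_kernel:
  assumes "w \<in> U"
  shows "(LINT z:U|lborel. F z w) = (\<integral>z. K z w \<partial>lborel)"
  unfolding set_lebesgue_integral_def
  by (rule integral_cong_AE)
     (use measurable_section[OF assms] off_diagonal_AE[OF assms] in auto)

text \<open>Translating the singularity to the origin makes the dominating function independent
  of \<open>w\<close>.\<close>

lemma continuous_on_integral:
  assumes "negligible (frontier U)"
  shows "continuous_on U (\<lambda>w. \<integral>z. K z w \<partial>lborel)"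
proof (rule continuous_on_sequentiallyI)
  fix w :: "nat \<Rightarrow> complex" and a
  assume w: "\<forall>n. w n \<in> U" and a: "a \<in> U" and lim: "w \<longlonglongrightarrow> a"
  have "frontier U \<in> null_sets lborel"
    using assms by (simp add: null_sets_completion_iff negligible_iff_null_sets)
  then have "frontier U \<in> null_sets (distr lborel borel ((+) a))"
    by (simp add: lborel_distr_plus)
  then have "AE z in distr lborel borel ((+) a). z \<notin> frontier U"
    by (rule AE_not_in)
  then have fr: "AE u in lborel. a + u \<notin> frontier U"
    by (subst (asm) AE_distr_iff) (auto simp: Collect_neg_eq)
  \<comment> \<open>If \<open>a + u\<close> lies in \<open>U\<close>, continuity of \<open>K\<close>
    off the diagonal applies; if it lies outside the closure, the terms are eventually 0. What
    remains is the null set where \<open>a + u\<close> is on the frontier, and the point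
    \<open>u = 0\<close>.\<close>
  have conv: "AE u in lborel. (\<lambda>n. K (w n + u) (w n)) \<longlonglongrightarrow> K (a + u) a"
    using fr AE_lborel_singleton[of 0]
  proof eventually_elim
    case (elim u)
    have lim': "(\<lambda>n. w n + u) \<longlonglongrightarrow> a + u" by (intro tendsto_intros lim)
    show ?case
    proof (cases "a + u \<in> U")
      case True
      have "((\<lambda>n. (\<lambda>p. K (fst p) (snd p)) (w n + u, w n)) \<longlongrightarrow> (\<lambda>p. K (fst p) (snd p)) (a + u, a)) sequentially"
        by (rule isCont_tendsto_compose[OF isCont_K[OF True a]])
           (use elim lim in \<open>auto intro!: tendsto_intros\<close>)
      then show ?thesis by simp
    next
      case False
      then have "a + u \<in> - closure U" using elim open_U by (auto simp: frontier_def interior_open)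
      then have "\<forall>\<^sub>F n in sequentially. w n + u \<in> - closure U"
        by (intro topological_tendstoD[OF lim']) auto
      then have "\<forall>\<^sub>F n in sequentially. K (w n + u) (w n) = K (a + u) a"
        by eventually_elim (use False closure_subset[of U] in \<open>auto simp: off_diagonal_def\<close>)
      then show ?thesis by (rule tendsto_eventually)
    qed
  qed
  show "(\<lambda>n. \<integral>z. K z (w n) \<partial>lborel) \<longlonglongrightarrow> (\<integral>z. K z a \<partial>lborel)"
    unfolding integral_translate
    by (rule integral_dominated_convergence[OF _ _ integrable_mult_right[OF integrable_inverse_norm_ball[of R], of C] conv])
       (use norm_K_translate_le in \<open>auto simp del: times_divide_eq_right mult_1_right\<close>)
qed

end

section \<open>Differentiation under the integral sign\<close>

text \<open>Dominating the difference quotients directly fails: the supremum of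
  \<open>1 / norm (z - v)\<close> over \<open>v\<close> on a segment is not integrable near that
  segment. Integrating the derivative first requires only bounds at each fixed \<open>v\<close>, and
  continuity of the integrated derivative then recovers the derivative itself.\<close>

lemma weakly_singular_has_vector_derivative:
  assumes F: "weakly_singular U F C R" and P: "weakly_singular U P B R"
    and fr: "negligible (frontier U)" and e: "norm e = 1" and w: "w \<in> U"
    and deriv: "\<And>z w. z \<in> U \<Longrightarrow> w \<in> U \<Longrightarrow> z \<noteq> w \<Longrightarrow>
      ((\<lambda>t. F z (w + e * of_real t)) has_vector_derivative P z w) (at 0)"
  shows "((\<lambda>t. LINT z:U|lborel. F z (w + e * of_real t))
           has_vector_derivative (LINT z:U|lborel. P z w)) (at 0)"
proof -
  interpret F: weakly_singular U F C R by fact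
  interpret P: weakly_singular U P B R by fact
  note [measurable] = P.measurable_K F.measurable_K
  obtain \<delta> where \<delta>: "\<delta> > 0" "cball w \<delta> \<subseteq> U"
    using F.open_U w open_contains_cball by blast
  define v where "v s = w + e * complex_of_real s" for s :: real
  have vU: "v s \<in> U" if "s \<in> {-\<delta>..\<delta>}" for s
    using that \<delta> e by (auto intro!: subsetD[OF \<delta>(2)] simp: v_def dist_norm norm_mult)
  have v_cont: "continuous_on S v" for S unfolding v_def by (intro continuous_intros)
  have v_meas [measurable]: "v \<in> borel_measurable borel"
    using v_cont by (rule borel_measurable_continuous_onI)
  define D where "D s = (\<integral>z. P.K z (v s) \<partial>lborel)" for s
  have D_cont: "continuous_on {-\<delta>..\<delta>} D"
    unfolding D_def
    by (rule continuous_on_compose2[OF P.continuous_on_integral[OF fr] v_cont]) (use vU in auto)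
  have e0: "e \<noteq> 0" using e by auto
  \<comment> \<open>The singularity moves along the line through \<open>w\<close> in direction
    \<open>e\<close>, which is a hyperplane with normal \<open>\<i> * e\<close> and hence null. For
    every other \<open>z\<close> the section is differentiable along the whole segment.\<close>
  have line: "AE z in lborel. \<forall>s. z \<noteq> v s"
  proof -
    have "{z. (\<i> * e) \<bullet> z = (\<i> * e) \<bullet> w} \<in> null_sets lborel"
      using e0 negligible_hyperplane[of "\<i> * e" "(\<i> * e) \<bullet> w"]
      by (auto simp: null_sets_completion_iff negligible_iff_null_sets closed_hyperplane)
    then have "AE z in lborel. z \<notin> {z. (\<i> * e) \<bullet> z = (\<i> * e) \<bullet> w}"
      by (rule AE_not_in)
    then show ?thesis
      by eventually_elim (auto simp: v_def inner_complex_def algebra_simps)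
  qed
  \<comment> \<open>The base point is \<open>-\<delta>\<close> rather than 0, so that 0 is interior
    to the interval and the derivative obtained there is two-sided.\<close>
  have step: "(\<integral>z. F.K z (v t) \<partial>lborel) = (\<integral>z. F.K z (v (-\<delta>)) \<partial>lborel) + integral {-\<delta>..t} D"
    if t: "t \<in> {-\<delta>..\<delta>}" for t
  proof -
    have pt: "(\<integral>s. indicator {-\<delta>..t} s *\<^sub>R P.K z (v s) \<partial>lborel) = F.K z (v t) - F.K z (v (-\<delta>))"
      if z: "\<forall>s. z \<noteq> v s" for z
    proof (cases "z \<in> U")
      case True
      have "(F.K z \<circ> v has_vector_derivative P.K z (v s)) (at s within {-\<delta>..t})"
        if s: "-\<delta> \<le> s" "s \<le> t" for s
      proof -
        have sU: "v s \<in> U" using vU s t by auto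
        have 1: "((\<lambda>x. x - s) has_vector_derivative 1) (at s)"
          by (auto intro!: derivative_eq_intros)
        have "((\<lambda>x. F z (v s + e * of_real x)) \<circ> (\<lambda>x. x - s) has_vector_derivative 1 *\<^sub>R P z (v s)) (at s)"
          by (rule vector_diff_chain_at[OF 1]) (use deriv[OF True sU] z in auto)
        then have "((\<lambda>x. F z (v x)) has_vector_derivative P z (v s)) (at s)"
          by (simp add: v_def o_def algebra_simps)
        then have "((\<lambda>x. F z (v x)) has_vector_derivative P z (v s)) (at s within {-\<delta>..t})"
          by (rule has_vector_derivative_at_within)
        moreover have "P.K z (v s) = P z (v s)"
          using True sU z by (auto simp: off_diagonal_def)
        ultimately show ?thesis
          by (intro has_vector_derivative_transform[of _ _ "F.K z \<circ> v" "\<lambda>x. F z (v x)"])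
             (use True z s t vU in \<open>auto simp: off_diagonal_def\<close>)
      qed
      moreover have "continuous_on {-\<delta>..t} (\<lambda>s. P.K z (v s))"
      proof (intro continuous_at_imp_continuous_on ballI)
        fix s assume s: "s \<in> {-\<delta>..t}"
        have "isCont (\<lambda>s. (z, v s)) s" unfolding v_def by (intro continuous_intros)
        then have "isCont (\<lambda>s. (\<lambda>p. P.K (fst p) (snd p)) (z, v s)) s"
          by (rule isCont_o2) (use P.isCont_K[of z "v s"] True z s t vU in auto)
        then show "isCont (\<lambda>s. P.K z (v s)) s" by simp
      qed
      ultimately show ?thesis
        using integral_FTC_Icc[of "-\<delta>" t "F.K z \<circ> v" "\<lambda>s. P.K z (v s)"] t by auto
    next
      case False
      then show ?thesis by (simp add: off_diagonal_def)
    qed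
    define f where "f s z = indicator {-\<delta>..t} s *\<^sub>R P.K z (v s)" for s z
    have f_meas [measurable]: "case_prod f \<in> borel_measurable (lborel \<Otimes>\<^sub>M lborel)"
      unfolding f_def by measurable
    \<comment> \<open>The inner integral of the norm is at most the constant \<open>c\<close> for
      each \<open>s\<close>, and \<open>s\<close> runs through a bounded interval.\<close>
    have f_int: "integrable (lborel \<Otimes>\<^sub>M lborel) (case_prod f)"
    proof (rule lborel_pair.Fubini_integrable)
      show "integrable lborel (\<lambda>s. \<integral>z. norm (case_prod f (s, z)) \<partial>lborel)"
      proof (rule Bochner_Integration.integrable_bound)
        define c where "c = B * (\<integral>u. indicator (ball (0::complex) R) u * (1 / norm u) \<partial>lborel)"
        show "integrable lborel (\<lambda>s. indicator {-\<delta>..t} s *\<^sub>R c)"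
          by (intro integrable_scaleR_left integrable_real_indicator) (auto simp: emeasure_lborel_Icc_eq)
        show "(\<lambda>s. \<integral>z. norm (case_prod f (s, z)) \<partial>lborel) \<in> borel_measurable lborel"
          by measurable
        show "AE s in lborel. norm (\<integral>z. norm (case_prod f (s, z)) \<partial>lborel) \<le> norm (indicator {-\<delta>..t} s *\<^sub>R c)"
        proof (rule AE_I2)
          fix s
          have "0 \<le> (\<integral>z. norm (P.K z (v s)) \<partial>lborel)" by simp
          then show "norm (\<integral>z. norm (case_prod f (s, z)) \<partial>lborel) \<le> norm (indicator {-\<delta>..t} s *\<^sub>R c)"
            using P.integral_norm_le[of "v s"] by (auto simp: f_def indicator_def c_def)
        qed
      qed
      show "AE s in lborel. integrable lborel (\<lambda>z. case_prod f (s, z))"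
        using P.integrable_K by (auto simp: f_def)
    qed measurable
    have "(\<integral>z. F.K z (v t) \<partial>lborel) - (\<integral>z. F.K z (v (-\<delta>)) \<partial>lborel) = (\<integral>z. F.K z (v t) - F.K z (v (-\<delta>)) \<partial>lborel)"
      by (simp add: F.integrable_K)
    also have "\<dots> = (\<integral>z. (\<integral>s. f s z \<partial>lborel) \<partial>lborel)"
    proof (rule integral_cong_AE)
      show "AE z in lborel. F.K z (v t) - F.K z (v (-\<delta>)) = (\<integral>s. f s z \<partial>lborel)"
        using line by eventually_elim (use pt in \<open>auto simp: f_def\<close>)
    qed measurable
    also have "\<dots> = (\<integral>s. (\<integral>z. f s z \<partial>lborel) \<partial>lborel)"
      by (rule lborel_pair.Fubini_integral[OF f_int])
    also have "\<dots> = (LINT s:{-\<delta>..t}|lborel. D s)"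
      unfolding set_lebesgue_integral_def f_def D_def by simp
    also have "\<dots> = integral {-\<delta>..t} D"
      by (intro set_borel_integral_eq_integral borel_integrable_atLeastAtMost')
         (rule continuous_on_subset[OF D_cont], use t in auto)
    finally show ?thesis by (simp add: algebra_simps)
  qed
  \<comment> \<open>Since \<open>D\<close> is continuous, the fundamental theorem of calculus
    differentiates the right-hand side of \<open>step\<close>.\<close>
  have "((\<lambda>t. (\<integral>z. F.K z (v (-\<delta>)) \<partial>lborel) + integral {-\<delta>..t} D) has_vector_derivative D 0) (at 0 within {-\<delta>..\<delta>})"
    by (subst add_0_left[of "D 0", symmetric], intro has_vector_derivative_add has_vector_derivative_const integral_has_vector_derivative D_cont)
       (use \<delta> in auto)
  then have "((\<lambda>t. LINT z:U|lborel. F z (v t)) has_vector_derivative D 0) (at 0 within {-\<delta>..\<delta>})"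
  proof (rule has_vector_derivative_transform[rotated 2])
    fix t assume t: "t \<in> {-\<delta>..\<delta>}"
    show "(LINT z:U|lborel. F z (v t)) = (\<integral>z. F.K z (v (-\<delta>)) \<partial>lborel) + integral {-\<delta>..t} D"
      unfolding F.set_integral_kernel[OF vU[OF t]] by (rule step[OF t])
  qed (use \<delta> in auto)
  then have "((\<lambda>t. LINT z:U|lborel. F z (v t)) has_vector_derivative D 0) (at 0)"
    using \<delta> by (simp add: at_within_Icc_at)
  then show ?thesis
    using P.set_integral_kernel[OF w] by (simp add: v_def D_def)
qed

subsection \<open>The Green kernel\<close>

text \<open>This is twice \<open>green_h\<close> with the upper endpoint \<open>s = 1 - q^2\<close>
  as variable, so that its derivative is just the integrand at \<open>s\<close>.\<close>

definition green_H :: "real \<Rightarrow> real \<Rightarrow> real" where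
  "green_H \<alpha> s = (LINT t:{0..s}|lborel. t powr \<alpha> / (1 - t))"

lemma continuous_on_green_integrand:
  assumes "\<alpha> > 0" "b < 1"
  shows "continuous_on {0..b} (\<lambda>t::real. t powr \<alpha> / (1 - t))"
  using assms by (intro continuous_on_divide continuous_on_powr' continuous_intros) auto

lemma green_H_eq_integral:
  assumes "\<alpha> > 0" "s < 1"
  shows "green_H \<alpha> s = integral {0..s} (\<lambda>t. t powr \<alpha> / (1 - t))"
  unfolding green_H_def
  by (intro set_borel_integral_eq_integral borel_integrable_atLeastAtMost' continuous_on_green_integrand assms)

lemma green_H_has_real_derivative:
  assumes "\<alpha> > 0" "0 < s" "s < 1"
  shows "(green_H \<alpha> has_real_derivative s powr \<alpha> / (1 - s)) (at s)"
proof -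
  \<comment> \<open>Any \<open>b\<close> strictly between \<open>s\<close> and 1 serves: the
    integrand is continuous up to \<open>b\<close>, and \<open>s\<close> is interior to
    \<open>{0..b}\<close>.\<close>
  define b where "b = (1 + s) / 2"
  have b: "s < b" "b < 1" using assms by (auto simp: b_def)
  have "((\<lambda>u. integral {0..u} (\<lambda>t. t powr \<alpha> / (1 - t))) has_real_derivative s powr \<alpha> / (1 - s)) (at s within {0..b})"
    by (rule integral_has_real_derivative) (use assms b continuous_on_green_integrand in auto)
  then have "((\<lambda>u. integral {0..u} (\<lambda>t. t powr \<alpha> / (1 - t))) has_real_derivative s powr \<alpha> / (1 - s)) (at s)"
    using assms b by (simp add: at_within_Icc_at)
  moreover have "\<forall>\<^sub>F u in nhds s. green_H \<alpha> u = integral {0..u} (\<lambda>t. t powr \<alpha> / (1 - t))"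
    by (rule eventually_mono[OF eventually_nhds_in_open[of "{..<1}"]])
       (use assms green_H_eq_integral in auto)
  ultimately show ?thesis by (subst DERIV_cong_ev) auto
qed

text \<open>Bound \<open>t powr \<alpha>\<close> by its value at \<open>s\<close> and integrate
  \<open>1 / (1 - t)\<close>. The factor \<open>s powr \<alpha>\<close> will absorb the growth of
  \<open>g\<close>, and the logarithm carries the singularity on the diagonal.\<close>

lemma green_H_bounds:
  assumes "\<alpha> > 0" "0 < s" "s < 1"
  shows "0 \<le> green_H \<alpha> s" "green_H \<alpha> s \<le> s powr \<alpha> * - ln (1 - s)"
proof -
  have int: "(\<lambda>t. t powr \<alpha> / (1 - t)) integrable_on {0..s}"
    by (intro integrable_continuous_real continuous_on_green_integrand) (use assms in auto)
  show "0 \<le> green_H \<alpha> s"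
    using assms by (simp add: green_H_eq_integral) (rule integral_nonneg[OF int], auto)
  have hi: "((\<lambda>t. 1 / (1 - t)) has_integral - ln (1 - s) - - ln (1 - 0)) {0..s}"
  proof (rule fundamental_theorem_of_calculus)
    fix x assume "x \<in> {0..s}"
    then show "((\<lambda>t. - ln (1 - t)) has_vector_derivative 1 / (1 - x)) (at x within {0..s})"
      unfolding has_real_derivative_iff_has_vector_derivative[symmetric]
      using assms by (auto intro!: derivative_eq_intros simp: field_simps)
  qed (use assms in auto)
  have "integral {0..s} (\<lambda>t. t powr \<alpha> / (1 - t)) \<le> s powr \<alpha> * (- ln (1 - s))"
  proof (rule has_integral_le[OF integrable_integral[OF int]])
    show "((\<lambda>t. s powr \<alpha> * (1 / (1 - t))) has_integral s powr \<alpha> * - ln (1 - s)) {0..s}"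
      using has_integral_mult_right[OF hi, of "s powr \<alpha>"] by simp
    fix t assume "t \<in> {0..s}"
    then show "t powr \<alpha> / (1 - t) \<le> s powr \<alpha> * (1 / (1 - t))"
      using assms by (auto intro!: divide_right_mono powr_mono2)
  qed
  then show "green_H \<alpha> s \<le> s powr \<alpha> * - ln (1 - s)"
    using assms by (simp add: green_H_eq_integral)
qed

section \<open>Elementary geometry of the disc\<close>

text \<open>On the disc this is \<open>1 - q\<^sup>2\<close>.\<close>

definition disc_s :: "complex \<Rightarrow> complex \<Rightarrow> real" where
  "disc_s z w = (1 - (norm z)\<^sup>2) * (1 - (norm w)\<^sup>2) / (norm (1 - cnj z * w))\<^sup>2"

text \<open>Both sides expand to \<open>1 - |z|^2 - |w|^2 + |z|^2 |w|^2\<close>. Division by the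
  first square on the left yields \<open>1 - q^2 = disc_s z w\<close>.\<close>

lemma norm_diff_identity:
  fixes z w :: complex
  shows "(norm (1 - cnj z * w))\<^sup>2 - (norm (z - w))\<^sup>2 = (1 - (norm z)\<^sup>2) * (1 - (norm w)\<^sup>2)"
  unfolding cmod_power2 by (simp add: power2_eq_square algebra_simps)

context
  fixes z w :: complex
  assumes z: "z \<in> \<bbbD>" and w: "w \<in> \<bbbD>"
begin

lemma norm_disc: "norm z < 1" "norm w < 1"
  using z w by (auto simp: unit_disc_def)

lemma norm_cnj_mult_less: "norm (cnj z * w) < 1"
proof -
  have "norm z * norm w \<le> norm w" using norm_disc by (intro mult_left_le_one_le) auto
  then show ?thesis using norm_disc by (simp add: norm_mult)
qed

lemma Re_one_minus_pos: "Re (1 - cnj z * w) > 0"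
  using norm_cnj_mult_less complex_Re_le_cmod[of "cnj z * w"] by simp

lemma norm_one_minus_pos: "norm (1 - cnj z * w) > 0"
  using Re_one_minus_pos complex_Re_le_cmod[of "1 - cnj z * w"] by linarith

lemma one_minus_norm_sq_pos: "1 - (norm z)\<^sup>2 > 0" "1 - (norm w)\<^sup>2 > 0"
  using norm_disc by (simp_all add: abs_square_less_1)

text \<open>Chain \<open>1 - |z|^2 \<le> 2 (1 - |z|) \<le> 2 (1 - |z| |w|)\<close> with the reverse
  triangle inequality, and likewise for \<open>w\<close>.\<close>

lemma one_minus_norm_sq_le:
  "1 - (norm z)\<^sup>2 \<le> 2 * norm (1 - cnj z * w)" "1 - (norm w)\<^sup>2 \<le> 2 * norm (1 - cnj z * w)"
proof -
  have 1: "1 - norm z * norm w \<le> norm (1 - cnj z * w)"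
    using norm_triangle_ineq2[of 1 "cnj z * w"] by (simp add: norm_mult)
  have 2: "norm z * norm w \<le> norm z" "norm z * norm w \<le> norm w"
    using norm_disc by (auto intro!: mult_left_le mult_left_le_one_le)
  have 3: "1 - x\<^sup>2 \<le> 2 * (1 - x)" for x :: real
    using zero_le_power2[of "1 - x"] by (simp add: power2_eq_square algebra_simps)
  show "1 - (norm z)\<^sup>2 \<le> 2 * norm (1 - cnj z * w)" "1 - (norm w)\<^sup>2 \<le> 2 * norm (1 - cnj z * w)"
    using 1 2 3[of "norm z"] 3[of "norm w"] by auto
qed

lemma norm_one_minus_le: "norm (1 - cnj z * w) \<le> 2"
  using norm_triangle_ineq4[of 1 "cnj z * w"] norm_cnj_mult_less by simp

lemma one_minus_disc_s: "1 - disc_s z w = (norm (z - w) / norm (1 - cnj z * w))\<^sup>2"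
  using norm_one_minus_pos norm_diff_identity[of z w]
  by (simp add: disc_s_def field_simps power_divide)

lemma disc_s_pos: "disc_s z w > 0"
  unfolding disc_s_def using one_minus_norm_sq_pos norm_one_minus_pos by (intro divide_pos_pos mult_pos_pos) auto

lemma disc_s_less_1:
  assumes "z \<noteq> w"
  shows "disc_s z w < 1"
proof -
  have "(norm (z - w) / norm (1 - cnj z * w))\<^sup>2 > 0"
    using assms norm_one_minus_pos by (intro zero_less_power divide_pos_pos) auto
  then show ?thesis using one_minus_disc_s by linarith
qed

lemma green_h_pseudohyp_dist:
  "green_h \<alpha> (pseudohyp_dist z w) = green_H \<alpha> (disc_s z w) / 2"
proof -
  have "norm (1 - cnj w * z) = norm (1 - cnj z * w)"
    by (metis complex_cnj_cnj complex_cnj_diff complex_cnj_mult complex_cnj_one complex_mod_cnj mult.commute)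
  then have "1 - (pseudohyp_dist z w)\<^sup>2 = disc_s z w"
    using one_minus_disc_s by (simp add: pseudohyp_dist_def norm_divide)
  then show ?thesis by (simp add: green_h_def green_H_def)
qed

end

section \<open>Directional derivatives of the kernel\<close>

text \<open>The derivative of \<open>disc_s z\<close> at \<open>w\<close> in direction
  \<open>e\<close>, factored so that its vanishing at \<open>z = w\<close> is visible. That zero
  offsets one of the two orders of the pole of \<open>1 / (1 - s)\<close>.\<close>

definition disc_s_deriv :: "complex \<Rightarrow> complex \<Rightarrow> complex \<Rightarrow> real" where
  "disc_s_deriv e z w = 2 * (1 - (norm z)\<^sup>2) * Re (e * cnj (z - w) * cnj (1 - cnj z * w)) / norm (1 - cnj z * w) ^ 4"

lemma disc_s_has_real_derivative:
  assumes "z \<in> \<bbbD>" "w \<in> \<bbbD>"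
  shows "((\<lambda>t. disc_s z (w + e * of_real t)) has_real_derivative disc_s_deriv e z w) (at 0)"
proof -
  define A where "A = 1 - cnj z * w"
  define B where "B = - cnj z * e"
  have A0: "norm A > 0" using norm_one_minus_pos[OF assms] by (simp add: A_def)
  \<comment> \<open>Along a real line squared norms are quadratic polynomials in \<open>t\<close>,
    so \<open>disc_s\<close> becomes a rational function of \<open>t\<close>.\<close>
  have sq: "(norm (a + b * of_real t))\<^sup>2 = (norm a)\<^sup>2 + 2 * (a \<bullet> b) * t + (norm b)\<^sup>2 * t\<^sup>2" for a b :: complex and t
    unfolding cmod_power2 by (simp add: inner_complex_def power2_eq_square algebra_simps)
  have eq: "disc_s z (w + e * of_real t) = (1 - (norm z)\<^sup>2) * (1 - ((norm w)\<^sup>2 + 2 * (w \<bullet> e) * t + (norm e)\<^sup>2 * t\<^sup>2))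
      / ((norm A)\<^sup>2 + 2 * (A \<bullet> B) * t + (norm B)\<^sup>2 * t\<^sup>2)" for t
  proof -
    have "1 - cnj z * (w + e * of_real t) = A + B * of_real t" by (simp add: A_def B_def algebra_simps)
    then show ?thesis unfolding disc_s_def by (simp only: sq)
  qed
  \<comment> \<open>Here the factor \<open>z - w\<close> emerges from the numerator of the quotient
    rule.\<close>
  have key: "- (w \<bullet> e) * (norm A)\<^sup>2 - (1 - (norm w)\<^sup>2) * (A \<bullet> B) = Re (e * cnj (z - w) * cnj A)"
    unfolding A_def B_def cmod_power2 by (simp add: inner_complex_def power2_eq_square algebra_simps)
  have "((\<lambda>t. disc_s z (w + e * of_real t)) has_real_derivative
     ((1 - (norm z)\<^sup>2) * (- (2 * (w \<bullet> e))) * (norm A)\<^sup>2 - (1 - (norm z)\<^sup>2) * (1 - (norm w)\<^sup>2) * (2 * (A \<bullet> B))) / ((norm A)\<^sup>2 * (norm A)\<^sup>2)) (at 0)"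
    unfolding eq using A0 by (auto intro!: derivative_eq_intros)
  also have "((1 - (norm z)\<^sup>2) * (- (2 * (w \<bullet> e))) * (norm A)\<^sup>2 - (1 - (norm z)\<^sup>2) * (1 - (norm w)\<^sup>2) * (2 * (A \<bullet> B))) / ((norm A)\<^sup>2 * (norm A)\<^sup>2)
     = 2 * (1 - (norm z)\<^sup>2) * (- (w \<bullet> e) * (norm A)\<^sup>2 - (1 - (norm w)\<^sup>2) * (A \<bullet> B)) / norm A ^ 4"
    by (simp add: algebra_simps power4_eq_xxxx power2_eq_square)
  finally show ?thesis unfolding key by (simp add: disc_s_deriv_def A_def)
qed

lemma green_kernel_eq:
  assumes "z \<in> \<bbbD>" "w \<in> \<bbbD>"
  shows "green_kernel \<alpha> z w =
    (1 - cnj z * w) powr of_real \<alpha> * of_real (green_H \<alpha> (disc_s z w)) / (4 * of_real pi)"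
  by (simp add: green_kernel_def green_h_pseudohyp_dist[OF assms])

text \<open>A general direction \<open>e\<close> lets one computation serve both partial
  derivatives, \<open>e = 1\<close> and \<open>e = \<i>\<close>. The first summand differentiates
  the power, the second differentiates \<open>green_H\<close> by the chain rule.\<close>

definition green_kernel_deriv :: "real \<Rightarrow> complex \<Rightarrow> complex \<Rightarrow> complex \<Rightarrow> complex" where
  "green_kernel_deriv \<alpha> e z w =
     (of_real \<alpha> * (1 - cnj z * w) powr (of_real \<alpha> - 1) * (- cnj z * e) * of_real (green_H \<alpha> (disc_s z w)) +
      (1 - cnj z * w) powr of_real \<alpha> *
        of_real (disc_s z w powr \<alpha> / (1 - disc_s z w) * disc_s_deriv e z w)) / (4 * of_real pi)"

lemma green_kernel_has_vector_derivative:
  assumes "\<alpha> > 0" "z \<in> \<bbbD>" "w \<in> \<bbbD>" "z \<noteq> w"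
  shows "((\<lambda>t. green_kernel \<alpha> z (w + e * of_real t)) has_vector_derivative green_kernel_deriv \<alpha> e z w) (at 0)"
proof -
  \<comment> \<open>Positive real part keeps the base off the branch cut of the principal
    power.\<close>
  have nonpos: "1 - cnj z * w \<notin> \<real>\<^sub>\<le>\<^sub>0"
    using Re_one_minus_pos[OF assms(2,3)] by (auto simp: complex_nonpos_Reals_iff)
  have "((\<lambda>t. 1 - cnj z * (w + e * of_real t)) has_vector_derivative (- cnj z * e)) (at 0)"
    by (auto intro!: derivative_eq_intros)
  moreover have "((\<lambda>u. u powr of_real \<alpha>) has_field_derivative of_real \<alpha> * (1 - cnj z * w) powr (of_real \<alpha> - 1))
      (at (1 - cnj z * (w + e * of_real 0)))"
    using has_field_derivative_powr[OF nonpos] by simp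
  ultimately have 1: "((\<lambda>u. u powr of_real \<alpha>) \<circ> (\<lambda>t. 1 - cnj z * (w + e * of_real t)) has_vector_derivative
      (- cnj z * e) * (of_real \<alpha> * (1 - cnj z * w) powr (of_real \<alpha> - 1))) (at 0)"
    by (rule field_vector_diff_chain_at)
  have "(green_H \<alpha> has_real_derivative disc_s z w powr \<alpha> / (1 - disc_s z w)) (at (disc_s z (w + e * of_real 0)))"
    using green_H_has_real_derivative[OF assms(1) disc_s_pos disc_s_less_1] assms by simp
  from DERIV_chain[OF this disc_s_has_real_derivative[OF assms(2,3), of e]]
  have "((\<lambda>t. green_H \<alpha> (disc_s z (w + e * of_real t))) has_real_derivative
      disc_s z w powr \<alpha> / (1 - disc_s z w) * disc_s_deriv e z w) (at 0)"
    by (simp add: o_def)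
  then have 2: "((\<lambda>t. complex_of_real (green_H \<alpha> (disc_s z (w + e * of_real t)))) has_vector_derivative
      of_real (disc_s z w powr \<alpha> / (1 - disc_s z w) * disc_s_deriv e z w)) (at 0)"
    by (intro has_vector_derivative_of_real) (simp add: has_real_derivative_iff_has_vector_derivative)
  have "((\<lambda>t. (1 - cnj z * (w + e * of_real t)) powr of_real \<alpha> *
      complex_of_real (green_H \<alpha> (disc_s z (w + e * of_real t))) / (4 * of_real pi))
      has_vector_derivative green_kernel_deriv \<alpha> e z w) (at 0)"
    by (rule has_vector_derivative_eq_rhs[OF has_vector_derivative_divide[OF has_vector_derivative_mult[OF 1[unfolded o_def] 2]]])
       (simp add: green_kernel_deriv_def algebra_simps)
  \<comment> \<open>The formula \<open>green_kernel_eq\<close> is available inside the disc only, so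
    the two functions are compared for \<open>t\<close> near 0.\<close>
  moreover have "\<forall>\<^sub>F t in nhds 0. w + e * complex_of_real t \<in> \<bbbD>"
    by (rule topological_tendstoD[of "\<lambda>t. w + e * complex_of_real t" w])
       (use assms in \<open>auto intro!: tendsto_eq_intros filterlim_ident simp: unit_disc_def\<close>)
  then have "\<forall>\<^sub>F t in nhds 0. green_kernel \<alpha> z (w + e * complex_of_real t) =
      (1 - cnj z * (w + e * of_real t)) powr of_real \<alpha> *
      complex_of_real (green_H \<alpha> (disc_s z (w + e * of_real t))) / (4 * of_real pi)"
    by eventually_elim (rule green_kernel_eq[OF assms(2)])
  ultimately show ?thesis
    by (subst has_vector_derivative_cong_ev) (auto simp: green_kernel_eq[OF assms(2,3)])
qed

section \<open>Singular bounds for the kernel and its derivatives\<close>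

text \<open>\<open>G\<close> stands for the value \<open>g z\<close>. In the notation of the proof,
  every term reduces to \<open>a powr \<alpha> * X / d\<close> times a bounded factor, and
  \<open>a powr \<alpha> * X\<close> is the constant \<open>M * 2 powr \<alpha>\<close>.\<close>

lemma green_kernel_bounds:
  assumes "\<alpha> > 0" "M \<ge> 0" "z \<in> \<bbbD>" "w \<in> \<bbbD>" "z \<noteq> w"
    and G: "norm G \<le> M * (1 - (norm z)\<^sup>2) powr (- \<alpha>)" and e: "norm e = 1"
  shows "norm (green_kernel \<alpha> z w * G) \<le> (M * 2 powr \<alpha> / pi) / norm (z - w)"
    and "norm (green_kernel_deriv \<alpha> e z w * G) \<le> (M * 2 powr \<alpha> * (\<alpha> + 2) / (2 * pi)) / norm (z - w)"
proof -
  define A where "A = 1 - cnj z * w"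
  define a where "a = norm A"
  define x where "x = 1 - (norm z)\<^sup>2"
  define y where "y = 1 - (norm w)\<^sup>2"
  define d where "d = norm (z - w)"
  define s where "s = disc_s z w"
  define X where "X = M * 2 powr \<alpha> * a powr (-\<alpha>)"
  note zw = assms(3,4)
  have a: "0 < a" "a \<le> 2" and x: "0 < x" "x \<le> 2 * a" and y: "0 < y" "y \<le> 2 * a" and d: "0 < d"
    using norm_one_minus_pos[OF zw] norm_one_minus_le[OF zw] one_minus_norm_sq_pos[OF zw]
      one_minus_norm_sq_le[OF zw] assms(5)
    by (auto simp: A_def a_def x_def y_def d_def)
  have s: "0 < s" "s < 1" "s = x * y / a\<^sup>2" "1 - s = (d / a)\<^sup>2"
    using disc_s_pos[OF zw] disc_s_less_1[OF zw assms(5)] one_minus_disc_s[OF zw]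
    by (auto simp: s_def a_def A_def d_def x_def y_def disc_s_def)
  \<comment> \<open>The factor \<open>x\<close> inside \<open>s\<close> cancels the growth of
    \<open>G\<close>; what remains is \<open>y / a^2\<close>, which is at most
    \<open>2 / a\<close>.\<close>
  have X: "s powr \<alpha> * norm G \<le> X"
  proof -
    have "s powr \<alpha> * norm G \<le> s powr \<alpha> * (M * x powr (- \<alpha>))"
      using G by (intro mult_left_mono) (auto simp: x_def)
    also have "\<dots> = M * (s / x) powr \<alpha>"
      by (simp add: powr_divide powr_minus field_simps)
    also have "s / x = y / a\<^sup>2" using s(3) x by simp
    also have "(y / a\<^sup>2) powr \<alpha> \<le> (2 / a) powr \<alpha>"
      using a y assms(1) by (intro powr_mono2) (auto simp: field_simps power2_eq_square)
    also have "M * (2 / a) powr \<alpha> = X"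
      by (simp add: X_def powr_divide powr_minus field_simps)
    finally show ?thesis using assms(2) by (simp add: mult_left_mono)
  qed
  have aX: "a powr \<alpha> * X = M * 2 powr \<alpha>"
    using a by (simp add: X_def powr_minus field_simps)
  have H: "green_H \<alpha> s \<ge> 0" "green_H \<alpha> s * norm G \<le> 2 * X * a / d"
  proof -
    show H0: "green_H \<alpha> s \<ge> 0" using green_H_bounds(1)[OF assms(1) s(1,2)] .
    \<comment> \<open>The logarithm is weakened to \<open>a / d\<close> by
      \<open>ln t \<le> t\<close>. The extra factor \<open>a\<close> makes up for the power of
      \<open>a\<close> lost when \<open>A powr \<alpha>\<close> is differentiated.\<close>
    have "- ln (1 - s) = 2 * ln (a / d)"
      using a d unfolding s(4) by (simp add: ln_realpow ln_div)
    also have "\<dots> \<le> 2 * (a / d)" using a d by (intro mult_left_mono ln_bound) auto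
    finally have "s powr \<alpha> * - ln (1 - s) \<le> s powr \<alpha> * (2 * (a / d))"
      by (intro mult_left_mono) auto
    then have "green_H \<alpha> s \<le> s powr \<alpha> * (2 * (a / d))"
      using green_H_bounds(2)[OF assms(1) s(1,2)] by linarith
    then have "green_H \<alpha> s * norm G \<le> s powr \<alpha> * (2 * (a / d)) * norm G"
      by (intro mult_right_mono) auto
    also have "\<dots> = (s powr \<alpha> * norm G) * (2 * (a / d))" by simp
    also have "\<dots> \<le> X * (2 * (a / d))"
      using X a d by (intro mult_right_mono) auto
    finally show "green_H \<alpha> s * norm G \<le> 2 * X * a / d" by (simp add: field_simps)
  qed
  have nA: "norm (A powr of_real \<beta>) = a powr \<beta>" for \<beta> :: real
    by (simp add: norm_powr_real_powr' a_def)
  have "norm (green_kernel \<alpha> z w * G) = a powr \<alpha> * (green_H \<alpha> s * norm G) / (4 * pi)"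
    using H(1) by (simp add: green_kernel_eq[OF zw] norm_mult norm_divide nA[unfolded A_def] s_def)
  also have "\<dots> \<le> a powr \<alpha> * (2 * X * a / d) / (4 * pi)"
    using H(2) by (intro divide_right_mono mult_left_mono) auto
  also have "\<dots> = M * 2 powr \<alpha> * (2 * a) / (4 * pi) / d"
    unfolding aX[symmetric] by simp
  also have "\<dots> \<le> M * 2 powr \<alpha> * 4 / (4 * pi) / d"
    using a d assms(2) by (intro divide_right_mono mult_left_mono) auto
  finally show "norm (green_kernel \<alpha> z w * G) \<le> (M * 2 powr \<alpha> / pi) / norm (z - w)"
    by (simp add: d_def)
  \<comment> \<open>One factor \<open>x \<le> 2 * a\<close> reduces the denominator from
    \<open>a^4\<close> to \<open>a^2\<close>, with the \<open>a\<close> from \<open>cnj A\<close>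
    included.\<close>
  have D: "\<bar>disc_s_deriv e z w\<bar> \<le> 4 * d / a\<^sup>2"
  proof -
    have "\<bar>Re (e * cnj (z - w) * cnj A)\<bar> \<le> d * a"
      using abs_Re_le_cmod[of "e * cnj (z - w) * cnj A"] e
      by (simp add: norm_mult d_def a_def del: complex_cnj_diff)
    then have "\<bar>disc_s_deriv e z w\<bar> \<le> 2 * (2 * a) * (d * a) / a ^ 4"
      unfolding disc_s_deriv_def abs_divide abs_mult using x
      by (intro divide_mono mult_mono) (auto simp: A_def a_def x_def)
    also have "\<dots> = 4 * d / a\<^sup>2" using a by (simp add: field_simps power2_eq_square power4_eq_xxxx)
    finally show ?thesis .
  qed
  have T2: "s powr \<alpha> / (1 - s) * \<bar>disc_s_deriv e z w\<bar> * norm G \<le> 4 * X / d"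
  proof -
    have "s powr \<alpha> / (1 - s) * \<bar>disc_s_deriv e z w\<bar> * norm G = (s powr \<alpha> * norm G) * (\<bar>disc_s_deriv e z w\<bar> / (1 - s))"
      by simp
    \<comment> \<open>As \<open>1 - s = (d / a)^2\<close>, the powers of \<open>a\<close> cancel and
      a simple singularity \<open>4 / d\<close> is left.\<close>
    also have "\<dots> \<le> X * ((4 * d / a\<^sup>2) / (1 - s))"
      using X D s assms(2) by (intro mult_mono divide_right_mono) (auto simp: X_def)
    also have "\<dots> = 4 * X / d" unfolding s(4) using a d by (simp add: field_simps power2_eq_square)
    finally show ?thesis .
  qed
  have nz: "norm (cnj z) \<le> 1" using norm_disc[OF zw] by simp
  have n1: "norm (A powr (of_real \<alpha> - 1)) = a powr (\<alpha> - 1)"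
    using nA[of "\<alpha> - 1"] by simp
  have "norm (green_kernel_deriv \<alpha> e z w * G) \<le>
     (norm (of_real \<alpha> * A powr (of_real \<alpha> - 1) * (- cnj z * e) * of_real (green_H \<alpha> s) * G) +
      norm (A powr of_real \<alpha> * of_real (s powr \<alpha> / (1 - s) * disc_s_deriv e z w) * G)) / (4 * pi)"
    unfolding green_kernel_deriv_def A_def[symmetric] s_def[symmetric]
    using norm_triangle_ineq[of "of_real \<alpha> * A powr (of_real \<alpha> - 1) * (- cnj z * e) * of_real (green_H \<alpha> s) * G"
        "A powr of_real \<alpha> * of_real (s powr \<alpha> / (1 - s) * disc_s_deriv e z w) * G"]
    by (simp only: times_divide_eq_left norm_divide distrib_right) (simp add: divide_right_mono)
  also have "\<dots> \<le> (\<alpha> * a powr (\<alpha> - 1) * (2 * X * a / d) + a powr \<alpha> * (4 * X / d)) / (4 * pi)"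
  proof (intro divide_right_mono add_mono)
    have "norm (of_real \<alpha> * A powr (of_real \<alpha> - 1) * (- cnj z * e) * of_real (green_H \<alpha> s) * G)
      = \<alpha> * a powr (\<alpha> - 1) * (norm z * (green_H \<alpha> s * norm G))"
      using H(1) assms(1) e by (simp add: norm_mult n1)
    also have "\<dots> \<le> \<alpha> * a powr (\<alpha> - 1) * (1 * (2 * X * a / d))"
      using H nz assms(1) by (intro mult_left_mono mult_mono) auto
    finally show "norm (of_real \<alpha> * A powr (of_real \<alpha> - 1) * (- cnj z * e) * of_real (green_H \<alpha> s) * G)
      \<le> \<alpha> * a powr (\<alpha> - 1) * (2 * X * a / d)" by simp
    have "norm (A powr of_real \<alpha> * of_real (s powr \<alpha> / (1 - s) * disc_s_deriv e z w) * G)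
      = a powr \<alpha> * (s powr \<alpha> / (1 - s) * \<bar>disc_s_deriv e z w\<bar> * norm G)"
      using s by (simp add: norm_mult norm_divide nA abs_mult del: of_real_mult of_real_divide)
    also have "\<dots> \<le> a powr \<alpha> * (4 * X / d)"
      by (intro mult_left_mono T2) auto
    finally show "norm (A powr of_real \<alpha> * of_real (s powr \<alpha> / (1 - s) * disc_s_deriv e z w) * G)
      \<le> a powr \<alpha> * (4 * X / d)" .
  qed auto
  also have "\<dots> = (a powr \<alpha> * X) * (\<alpha> + 2) / (2 * pi) / d"
    using a d by (simp add: powr_diff field_simps)
  finally show "norm (green_kernel_deriv \<alpha> e z w * G) \<le> (M * 2 powr \<alpha> * (\<alpha> + 2) / (2 * pi)) / norm (z - w)"
    unfolding aX by (simp add: d_def)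
qed

section \<open>Continuity off the diagonal\<close>

abbreviation (input) off_diagonal_pairs :: "(complex \<times> complex) set" where
  "off_diagonal_pairs \<equiv> {p. fst p \<in> \<bbbD> \<and> snd p \<in> \<bbbD> \<and> fst p \<noteq> snd p}"

text \<open>Off the diagonal \<open>disc_s\<close> stays strictly between 0 and 1, where
  \<open>green_H\<close> is differentiable and \<open>1 / (1 - s)\<close> is finite; the base of the
  complex power has positive real part.\<close>

lemma continuous_on_green_kernels:
  assumes "\<alpha> > 0"
  shows "continuous_on off_diagonal_pairs (\<lambda>p. green_kernel \<alpha> (fst p) (snd p))"
    and "continuous_on off_diagonal_pairs (\<lambda>p. green_kernel_deriv \<alpha> e (fst p) (snd p))"
proof -
  have s01: "disc_s (fst p) (snd p) \<in> {0<..<1}" if "p \<in> off_diagonal_pairs" for p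
    using disc_s_pos disc_s_less_1 that by auto
  have A0: "1 - cnj (fst p) * snd p \<noteq> 0" if "p \<in> off_diagonal_pairs" for p
    using norm_one_minus_pos[of "fst p" "snd p"] that by auto
  have s: "continuous_on off_diagonal_pairs (\<lambda>p. disc_s (fst p) (snd p))"
    unfolding disc_s_def using A0 by (intro continuous_intros) auto
  have ds: "continuous_on off_diagonal_pairs (\<lambda>p. disc_s_deriv e (fst p) (snd p))"
    unfolding disc_s_deriv_def using A0 by (intro continuous_intros) auto
  have "continuous_on {0<..<1} (green_H \<alpha>)"
    using green_H_has_real_derivative[OF assms]
    by (intro continuous_at_imp_continuous_on ballI DERIV_isCont) auto
  from continuous_on_compose2[OF this s]
  have H: "continuous_on off_diagonal_pairs (\<lambda>p. green_H \<alpha> (disc_s (fst p) (snd p)))"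
    using s01 by blast
  have pw: "continuous_on off_diagonal_pairs (\<lambda>p. (1 - cnj (fst p) * snd p) powr c)" for c
    by (intro continuous_on_powr_complex continuous_intros)
       (use A0 Re_one_minus_pos in \<open>auto simp: less_imp_le\<close>)
  have "continuous_on off_diagonal_pairs (\<lambda>p. (1 - cnj (fst p) * snd p) powr of_real \<alpha> *
      of_real (green_H \<alpha> (disc_s (fst p) (snd p))) / (4 * of_real pi))"
    by (intro continuous_intros pw H) auto
  then show "continuous_on off_diagonal_pairs (\<lambda>p. green_kernel \<alpha> (fst p) (snd p))"
    by (rule continuous_on_eq) (auto simp: green_kernel_eq)
  have q: "continuous_on off_diagonal_pairs (\<lambda>p. disc_s (fst p) (snd p) powr \<alpha> / (1 - disc_s (fst p) (snd p)))"
    by (intro continuous_intros s) (use s01 in fastforce)+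
  have "continuous_on off_diagonal_pairs (\<lambda>p. disc_s (fst p) (snd p) powr \<alpha> /
      (1 - disc_s (fst p) (snd p)) * disc_s_deriv e (fst p) (snd p))"
    by (rule continuous_on_mult[OF q ds])
  from continuous_on_of_real[OF this]
  have "continuous_on off_diagonal_pairs (\<lambda>p. complex_of_real (disc_s (fst p) (snd p) powr \<alpha> /
      (1 - disc_s (fst p) (snd p)) * disc_s_deriv e (fst p) (snd p)))" .
  then show "continuous_on off_diagonal_pairs (\<lambda>p. green_kernel_deriv \<alpha> e (fst p) (snd p))"
    unfolding green_kernel_deriv_def
    by (intro continuous_on_divide continuous_on_mult continuous_on_add
        continuous_on_minus continuous_on_cnj continuous_on_fst continuous_on_id continuous_on_const
        pw continuous_on_of_real[OF H]) auto
qed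

section \<open>Derivatives of the Green potential\<close>

theorem theorem7:
  fixes \<alpha> M :: real and g :: "complex \<Rightarrow> complex"
  assumes "\<alpha> > 0"
    and "continuous_on \<bbbD> g"
    and "M > 0"
    and "\<And>z. z \<in> \<bbbD> \<Longrightarrow> norm (g z) \<le> M * (1 - (norm z)\<^sup>2) powr (- \<alpha>)"
  shows "(\<forall>w\<in>\<bbbD>. set_integrable lborel \<bbbD> (\<lambda>z. green_kernel \<alpha> z w * g z)) \<and>
         (\<forall>w\<in>\<bbbD>. has_partials_at (green_potential \<alpha> g) w) \<and>
         bounded (wirtinger (green_potential \<alpha> g) ` \<bbbD>) \<and>
         bounded (wirtinger_bar (green_potential \<alpha> g) ` \<bbbD>)"
proof -
  \<comment> \<open>\<open>B\<close> is the singular bound for the kernel derivatives, the same for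
    every unit direction. \<open>L\<close> is the resulting bound for the partial derivatives; the
    radius 2 is the diameter of the disc.\<close>
  define B where "B = M * 2 powr \<alpha> * (\<alpha> + 2) / (2 * pi)"
  define L where "L = B * (\<integral>u. indicator (ball (0::complex) 2) u * (1 / norm u) \<partial>lborel)"
  define dV where "dV e w = (LINT z:\<bbbD>|lborel. green_kernel_deriv \<alpha> e z w * g z)" for e w
  have gcont: "continuous_on off_diagonal_pairs (\<lambda>p. g (fst p))"
    by (rule continuous_on_compose2[OF assms(2)]) (auto intro!: continuous_intros)
  have diam: "norm (z - w) < 2" if "z \<in> \<bbbD>" "w \<in> \<bbbD>" for z w
    using norm_triangle_ineq4[of z w] that by (simp add: unit_disc_def)
  have fr: "negligible (frontier \<bbbD>)"
    by (auto simp: unit_disc_def intro!: negligible_convex_frontier simp del: frontier_ball)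
  have F: "weakly_singular \<bbbD> (\<lambda>z w. green_kernel \<alpha> z w * g z) (M * 2 powr \<alpha> / pi) 2"
  proof
    show "continuous_on off_diagonal_pairs (\<lambda>p. green_kernel \<alpha> (fst p) (snd p) * g (fst p))"
      by (intro continuous_on_mult continuous_on_green_kernels gcont assms(1))
    show "norm (green_kernel \<alpha> z w * g z) \<le> (M * 2 powr \<alpha> / pi) / norm (z - w)"
      if "z \<in> \<bbbD>" "w \<in> \<bbbD>" "z \<noteq> w" for z w
      by (rule green_kernel_bounds(1)[where e = 1]) (use that assms in auto)
  qed (use diam assms(3) in \<open>auto simp: unit_disc_def\<close>)
  have P: "weakly_singular \<bbbD> (\<lambda>z w. green_kernel_deriv \<alpha> e z w * g z) B 2" if e: "norm e = 1" for e
  proof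
    show "continuous_on off_diagonal_pairs (\<lambda>p. green_kernel_deriv \<alpha> e (fst p) (snd p) * g (fst p))"
      by (intro continuous_on_mult continuous_on_green_kernels gcont assms(1))
    show "norm (green_kernel_deriv \<alpha> e z w * g z) \<le> B / norm (z - w)"
      if "z \<in> \<bbbD>" "w \<in> \<bbbD>" "z \<noteq> w" for z w
      unfolding B_def by (rule green_kernel_bounds(2)) (use that assms e in auto)
  qed (use diam assms(1,3) in \<open>auto simp: unit_disc_def B_def\<close>)
  have deriv: "((\<lambda>t. green_potential \<alpha> g (w + e * of_real t)) has_vector_derivative dV e w) (at 0)"
    if "norm e = 1" "w \<in> \<bbbD>" for e w
    unfolding green_potential_def dV_def
    by (rule weakly_singular_has_vector_derivative[OF F P[OF that(1)] fr that])
       (intro has_vector_derivative_mult_left green_kernel_has_vector_derivative assms(1))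
  have dV_le: "norm (dV e w) \<le> L" if "norm e = 1" "w \<in> \<bbbD>" for e w
    using weakly_singular.norm_integral_le[OF P[OF that(1)], of w]
      weakly_singular.set_integral_kernel[OF P[OF that(1)] that(2)]
    by (simp add: dV_def L_def)
  have Re: "partial_Re (green_potential \<alpha> g) w = dV 1 w" if "w \<in> \<bbbD>" for w
    using deriv[of 1 w] that by (simp add: partial_Re_def vector_derivative_at)
  have Im: "partial_Im (green_potential \<alpha> g) w = dV \<i> w" if "w \<in> \<bbbD>" for w
    using deriv[of \<i> w] that by (simp add: partial_Im_def vector_derivative_at)
  have partials: "has_partials_at (green_potential \<alpha> g) w" if "w \<in> \<bbbD>" for w
    using deriv[of 1 w] deriv[of \<i> w] that
    by (auto simp: has_partials_at_def intro: differentiableI_vector)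
  \<comment> \<open>The factor 1/2 averages two terms of norm at most \<open>L\<close>, so both
    Wirtinger derivatives inherit the same bound.\<close>
  have comb: "norm ((a - \<i> * b) / 2) \<le> L" "norm ((a + \<i> * b) / 2) \<le> L" if "norm a \<le> L" "norm b \<le> L" for a b
    using norm_triangle_ineq4[of a "\<i> * b"] norm_triangle_ineq[of a "\<i> * b"] that
    by (simp_all add: norm_divide norm_mult)
  have "norm (wirtinger (green_potential \<alpha> g) w) \<le> L" "norm (wirtinger_bar (green_potential \<alpha> g) w) \<le> L"
    if "w \<in> \<bbbD>" for w
    using comb[OF dV_le[of 1 w] dV_le[of \<i> w]] that
    by (simp_all add: wirtinger_def wirtinger_bar_def Re Im)
  then show ?thesis
    using partials weakly_singular.set_integrable_kernel[OF F] by (auto simp: bounded_iff)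
qed

end
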